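(* Let $\mathfrak{X}$ be a homogeneous tree in which every vertex has the same number, $q+1$ say, of nearest neighbours, let $G$ be its group of isometries and let $o$ be a fixed reference vertex. Suppose that $\mathcal{T}$ is a $G$-invariant linear operator defined on functions on $\mathfrak{X}$ with finite support, and denote by $k$ its kernel. Say that $k$ satisfies the local Hörmander type integral condition if $$\max_{y\sim o}\ \sum_{x:\rho(x,o)\ge 2}|k(x,y)-k(x,o)|<\infty.$$ The following hold: (i) if $\mathcal{T}$ extends to a bounded operator from $H^1(\mathfrak{X})$ to $L^1(\mathfrak{X})$, then $k$ satisfies the local Hörmander type integral condition; (ii) if $k$ satisfies the local Hörmander type integral condition, then $$\sum_{x\in\mathfrak{X}}|k(x,o)|<\infty.$$ Hence $\mathcal{T}$ is bounded on $L^1(\mathfrak{X})$; (iii) $\mathcal{T}$ extends to a bounded operator from $H^1(\mathfrak{X})$ to $L^1(\mathfrak{X})$ if and only if $\mathcal{T}$ extends to a bounded operator from $\mathfrak{h}^1(\mathfrak{X})$ to $L^1(\mathfrak{X})$.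
   Context: A homogeneous tree is a connected graph with no loops (that is, no cycles), identified with its vertex set, in which every vertex has the same number $q+1$ of adjacent vertices (nearest neighbours). $x\sim y$ means that $x$ and $y$ are adjacent. $\mu$ is the counting measure on $\mathfrak{X}$, and $\rho$ is one half of the natural graph distance, so that adjacent vertices have $\rho$-distance $1/2$. Balls are (open) balls with respect to $\rho$. $L^p(\mathfrak{X})=L^p(\mu)$. The kernel of $\mathcal{T}$ is the function $k$ on $\mathfrak{X}\times\mathfrak{X}$ with $\mathcal{T}f(x)=\sum_{y\in\mathfrak{X}}k(x,y)f(y)$ for finitely supported $f$. $\mathcal{T}$ is $G$-invariant if it commutes with the action of $G$, so that $k(g\cdot x,g\cdot y)=k(x,y)$ for all $g\in G$ and $x,y\in\mathfrak{X}$; thus $k(x,y)$ depends only on $\rho(x,y)$. An $H^1(\mathfrak{X})$-atom is a function $a\in L^2(\mathfrak{X})$ supported in a ball $B$ of radius at most $1$ such that $\|a\|_2\le\mu(B)^{-1/2}$ and $\sum_x a(x)=0$. A global atom is a function $a\in L^2(\mathfrak{X})$ supported in a ball $B$ of radius exactly $1$ such that $\|a\|_2\le\mu(B)^{-1/2}$. An $\mathfrak{h}^1(\mathfrak{X})$-atom is either an $H^1(\mathfrak{X})$-atom or a global atom. $H^1(\mathfrak{X})$ (resp. $\mathfrak{h}^1(\mathfrak{X})$) is the space of all functions $f=\sum_j\lambda_ja_j$ with $a_j$ $H^1(\mathfrak{X})$-atoms (resp. $\mathfrak{h}^1(\mathfrak{X})$-atoms) and $\sum_j|\lambda_j|<\infty$,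 normed by the infimum of $\sum_j|\lambda_j|$ over all such decompositions.
   Formalization: In (ii), and in the direction from H^1 to h^1 of (iii), it is additionally assumed that q≠1 and that k(x,o) tends to 0 as x goes to infinity; without these the claims fail (k≡1; or k(x,y)=1/(1+|x−y|) on the tree Z). *)

theory Defs
  imports "HOL-Analysis.Analysis"
begin

text \<open>The vertex set is the whole type; the edges are an adjacency relation.\<close>

definition graph_cycle :: "('a \<Rightarrow> 'a \<Rightarrow> bool) \<Rightarrow> 'a list \<Rightarrow> bool" where
  "graph_cycle adj xs \<longleftrightarrow>
     3 \<le> length xs \<and> distinct xs \<and> successively adj xs \<and> adj (last xs) (hd xs)"

text \<open>As \<open>card\<close> of an infinite set is \<open>0\<close>, the last conjunct also says that every vertex
  has only finitely many neighbours.\<close>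

definition homogeneous_tree :: "('a \<Rightarrow> 'a \<Rightarrow> bool) \<Rightarrow> nat \<Rightarrow> bool" where
  "homogeneous_tree adj q \<longleftrightarrow>
     symp adj \<and> irreflp adj \<and>
     (\<forall>x y. adj\<^sup>*\<^sup>* x y) \<and>
     (\<nexists>xs. graph_cycle adj xs) \<and>
     (\<forall>x. card {y. adj x y} = q + 1)"

definition graph_dist :: "('a \<Rightarrow> 'a \<Rightarrow> bool) \<Rightarrow> 'a \<Rightarrow> 'a \<Rightarrow> nat" where
  "graph_dist adj x y = (LEAST n. (adj ^^ n) x y)"

definition rho :: "('a \<Rightarrow> 'a \<Rightarrow> bool) \<Rightarrow> 'a \<Rightarrow> 'a \<Rightarrow> real" where
  "rho adj x y = real (graph_dist adj x y) / 2"

definition tree_ball :: "('a \<Rightarrow> 'a \<Rightarrow> bool) \<Rightarrow> 'a \<Rightarrow> real \<Rightarrow> 'a set" where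
  "tree_ball adj c r = {x. rho adj c x < r}"

definition isometries :: "('a \<Rightarrow> 'a \<Rightarrow> bool) \<Rightarrow> ('a \<Rightarrow> 'a) set" where
  "isometries adj = {g. bij g \<and> (\<forall>x y. rho adj (g x) (g y) = rho adj x y)}"

definition finsupp :: "('a \<Rightarrow> complex) set" where
  "finsupp = {f. finite {x. f x \<noteq> 0}}"

definition L1 :: "('a \<Rightarrow> complex) set" where
  "L1 = {f. (\<lambda>x. cmod (f x)) summable_on UNIV}"

definition L1_norm :: "('a \<Rightarrow> complex) \<Rightarrow> real" where
  "L1_norm f = (\<Sum>\<^sub>\<infinity>x. cmod (f x))"

definition L2 :: "('a \<Rightarrow> complex) set" where
  "L2 = {f. (\<lambda>x. (cmod (f x))\<^sup>2) summable_on UNIV}"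

definition L2_norm :: "('a \<Rightarrow> complex) \<Rightarrow> real" where
  "L2_norm f = sqrt (\<Sum>\<^sub>\<infinity>x. (cmod (f x))\<^sup>2)"

definition mu :: "'a set \<Rightarrow> real" where
  "mu B = measure (count_space UNIV) B"

definition H1_atom :: "('a \<Rightarrow> 'a \<Rightarrow> bool) \<Rightarrow> ('a \<Rightarrow> complex) \<Rightarrow> bool" where
  "H1_atom adj a \<longleftrightarrow>
     a \<in> L2 \<and>
     (\<exists>c r. 0 < r \<and> r \<le> 1 \<and> {x. a x \<noteq> 0} \<subseteq> tree_ball adj c r \<and>
        L2_norm a \<le> mu (tree_ball adj c r) powr (-1/2)) \<and>
     (a has_sum 0) UNIV"

definition global_atom :: "('a \<Rightarrow> 'a \<Rightarrow> bool) \<Rightarrow> ('a \<Rightarrow> complex) \<Rightarrow> bool" where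
  "global_atom adj a \<longleftrightarrow>
     a \<in> L2 \<and>
     (\<exists>c. {x. a x \<noteq> 0} \<subseteq> tree_ball adj c 1 \<and>
        L2_norm a \<le> mu (tree_ball adj c 1) powr (-1/2))"

definition h1_atom :: "('a \<Rightarrow> 'a \<Rightarrow> bool) \<Rightarrow> ('a \<Rightarrow> complex) \<Rightarrow> bool" where
  "h1_atom adj a \<longleftrightarrow> H1_atom adj a \<or> global_atom adj a"

text \<open>Every atom has L1-norm at most 1, so under the summability condition on the coefficients
  the atomic series converges absolutely in L1 and its sum there is the pointwise sum.
  Finite sums are included, because the zero function is an atom.\<close>

definition atomic_decomposition ::
  "(('a \<Rightarrow> complex) \<Rightarrow> bool) \<Rightarrow> ('a \<Rightarrow> complex) \<Rightarrow> (nat \<Rightarrow> complex) \<Rightarrow> (nat \<Rightarrow> 'a \<Rightarrow> complex) \<Rightarrow> bool"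
  where
  "atomic_decomposition atom f c a \<longleftrightarrow>
     (\<forall>j. atom (a j)) \<and> summable (\<lambda>j. cmod (c j)) \<and> (\<forall>x. (\<lambda>j. c j * a j x) sums f x)"

definition atomic_space :: "(('a \<Rightarrow> complex) \<Rightarrow> bool) \<Rightarrow> ('a \<Rightarrow> complex) set" where
  "atomic_space atom = {f. \<exists>c a. atomic_decomposition atom f c a}"

definition atomic_norm :: "(('a \<Rightarrow> complex) \<Rightarrow> bool) \<Rightarrow> ('a \<Rightarrow> complex) \<Rightarrow> real" where
  "atomic_norm atom f = Inf {\<Sum>j. cmod (c j) | c a. atomic_decomposition atom f c a}"

abbreviation H1 :: "('a \<Rightarrow> 'a \<Rightarrow> bool) \<Rightarrow> ('a \<Rightarrow> complex) set" where
  "H1 adj \<equiv> atomic_space (H1_atom adj)"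

abbreviation H1_norm :: "('a \<Rightarrow> 'a \<Rightarrow> bool) \<Rightarrow> ('a \<Rightarrow> complex) \<Rightarrow> real" where
  "H1_norm adj \<equiv> atomic_norm (H1_atom adj)"

abbreviation h1 :: "('a \<Rightarrow> 'a \<Rightarrow> bool) \<Rightarrow> ('a \<Rightarrow> complex) set" where
  "h1 adj \<equiv> atomic_space (h1_atom adj)"

abbreviation h1_norm :: "('a \<Rightarrow> 'a \<Rightarrow> bool) \<Rightarrow> ('a \<Rightarrow> complex) \<Rightarrow> real" where
  "h1_norm adj \<equiv> atomic_norm (h1_atom adj)"

text \<open>An operator with domain \<open>X\<close> is a total function whose values outside \<open>X\<close> are irrelevant.\<close>

definition linear_operator_on ::
  "('a \<Rightarrow> complex) set \<Rightarrow> (('a \<Rightarrow> complex) \<Rightarrow> ('a \<Rightarrow> complex)) \<Rightarrow> bool" where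
  "linear_operator_on X S \<longleftrightarrow>
     (\<forall>f\<in>X. \<forall>g\<in>X. S (\<lambda>x. f x + g x) = (\<lambda>x. S f x + S g x)) \<and>
     (\<forall>f\<in>X. \<forall>c. S (\<lambda>x. c * f x) = (\<lambda>x. c * S f x))"

definition is_kernel ::
  "(('a \<Rightarrow> complex) \<Rightarrow> ('a \<Rightarrow> complex)) \<Rightarrow> ('a \<Rightarrow> 'a \<Rightarrow> complex) \<Rightarrow> bool" where
  "is_kernel T k \<longleftrightarrow> (\<forall>f\<in>finsupp. \<forall>x. T f x = (\<Sum>y | f y \<noteq> 0. k x y * f y))"

definition G_invariant ::
  "('a \<Rightarrow> 'a \<Rightarrow> bool) \<Rightarrow> (('a \<Rightarrow> complex) \<Rightarrow> ('a \<Rightarrow> complex)) \<Rightarrow> bool" where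
  "G_invariant adj T \<longleftrightarrow> (\<forall>g\<in>isometries adj. \<forall>f\<in>finsupp. T (f \<circ> inv g) = T f \<circ> inv g)"

text \<open>\<open>T\<close>, given on finitely supported functions, extends to a bounded operator from the space
  \<open>X\<close> with norm \<open>N\<close> to L1. A space such as \<open>H1\<close> does not contain all finitely supported
  functions; the extension has to agree with \<open>T\<close> on those it contains.\<close>

definition extends_bounded_to_L1 ::
  "('a \<Rightarrow> complex) set \<Rightarrow> (('a \<Rightarrow> complex) \<Rightarrow> real) \<Rightarrow> (('a \<Rightarrow> complex) \<Rightarrow> ('a \<Rightarrow> complex)) \<Rightarrow> bool"
  where
  "extends_bounded_to_L1 X N T \<longleftrightarrow>
     (\<exists>S. linear_operator_on X S \<and>
          (\<forall>f\<in>X \<inter> finsupp. S f = T f) \<and>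
          (\<exists>C. \<forall>f\<in>X. S f \<in> L1 \<and> L1_norm (S f) \<le> C * N f))"

definition local_Hormander ::
  "('a \<Rightarrow> 'a \<Rightarrow> bool) \<Rightarrow> 'a \<Rightarrow> ('a \<Rightarrow> 'a \<Rightarrow> complex) \<Rightarrow> bool" where
  "local_Hormander adj v k \<longleftrightarrow>
     (MAX y\<in>{y. adj y v}. \<Sum>\<^sub>\<infinity>x\<in>{x. rho adj x v \<ge> 2}. ennreal (cmod (k x y - k x v))) < \<infinity>"

text \<open>The kernel vanishes at infinity: neighbourhoods of infinity in the discrete space of
  vertices are the complements of finite sets.\<close>

definition vanishes_at_infinity :: "('a \<Rightarrow> complex) \<Rightarrow> bool" where
  "vanishes_at_infinity f \<longleftrightarrow> (f \<longlongrightarrow> 0) cofinite"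

end

theory Submission
  imports Defs
begin

text \<open>For neighbours \<open>y\<close> and \<open>v\<close>, the difference of their indicator functions is a multiple of an
  atom, which gives (i). For (ii), the isometry group is transitive on pairs of vertices at a given
  distance, so the kernel is \<open>\<kappa>\<close> of the distance. Every \<open>x \<noteq> v\<close> is closer to some
  neighbour of \<open>v\<close> than to \<open>v\<close>, so the integral condition bounds
  \<open>\<Sum>\<^sub>n N\<^sub>n |\<kappa>(n) - \<kappa>(n - 1)|\<close>, where \<open>N\<^sub>n\<close> is the size of the sphere of radius \<open>n\<close>.
  For \<open>q \<ge> 2\<close> the spheres at least double in size with \<open>n\<close> and \<open>\<kappa>\<close> tends to \<open>0\<close>, so
  summation by parts bounds \<open>\<Sum>\<^sub>n N\<^sub>n |\<kappa>(n)|\<close>. Then (iii) follows, since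
  \<open>H\<^sup>1 \<subseteq> h\<^sup>1 \<subseteq> L\<^sup>1\<close> with decreasing norms.\<close>

section \<open>Summation and operators into L1\<close>

lemma bij_betw_marked:
  assumes "finite A" "finite B" "card A = card B" "card (A \<inter> M) = card (B \<inter> M')"
  shows "\<exists>b. bij_betw b A B \<and> (\<forall>z\<in>A. b z \<in> M' \<longleftrightarrow> z \<in> M)"
proof -
  have "card (A - M) = card (B - M')" using assms by (simp add: card_Diff_subset_Int)
  then obtain f h where f: "bij_betw f (A \<inter> M) (B \<inter> M')" and h: "bij_betw h (A - M) (B - M')"
    using assms finite_same_card_bij by (metis finite_Diff finite_Int)
  define b where "b z = (if z \<in> M then f z else h z)" for z
  have "bij_betw b (A \<inter> M) (B \<inter> M')"
    using f by (rule bij_betw_cong[THEN iffD2, rotated]) (auto simp: b_def)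
  moreover have "bij_betw b (A - M) (B - M')"
    using h by (rule bij_betw_cong[THEN iffD2, rotated]) (auto simp: b_def)
  ultimately have "bij_betw b ((A \<inter> M) \<union> (A - M)) ((B \<inter> M') \<union> (B - M'))"
    by (rule bij_betw_combine) auto
  moreover have "(A \<inter> M) \<union> (A - M) = A" "(B \<inter> M') \<union> (B - M') = B" by auto
  moreover have "\<forall>z\<in>A. b z \<in> M' \<longleftrightarrow> z \<in> M"
    using f h by (auto simp: b_def bij_betw_def)
  ultimately show ?thesis by auto
qed

lemma infsum_ennreal_finite_iff:
  fixes f :: "'a \<Rightarrow> real"
  assumes f: "\<And>x. 0 \<le> f x"
  shows "(\<Sum>\<^sub>\<infinity>x\<in>A. ennreal (f x)) < \<infinity> \<longleftrightarrow> (\<exists>K. \<forall>F. finite F \<longrightarrow> F \<subseteq> A \<longrightarrow> sum f F \<le> K)"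
proof
  assume fin: "(\<Sum>\<^sub>\<infinity>x\<in>A. ennreal (f x)) < \<infinity>"
  have "sum f F \<le> enn2real (\<Sum>\<^sub>\<infinity>x\<in>A. ennreal (f x))" if "finite F" "F \<subseteq> A" for F
  proof -
    have "ennreal (sum f F) = (\<Sum>x\<in>F. ennreal (f x))" using f by simp
    also have "\<dots> \<le> (\<Sum>\<^sub>\<infinity>x\<in>A. ennreal (f x))"
      unfolding infsum_finite[OF that(1), symmetric]
      using that by (intro infsum_mono_neutral nonneg_summable_on_complete) auto
    finally show ?thesis using fin f
      by (metis enn2real_ennreal enn2real_mono infinity_ennreal_def sum_nonneg)
  qed
  then show "\<exists>K. \<forall>F. finite F \<longrightarrow> F \<subseteq> A \<longrightarrow> sum f F \<le> K" by blast
next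
  assume "\<exists>K. \<forall>F. finite F \<longrightarrow> F \<subseteq> A \<longrightarrow> sum f F \<le> K"
  then obtain K where K: "\<And>F. finite F \<Longrightarrow> F \<subseteq> A \<Longrightarrow> sum f F \<le> K" by blast
  have "(\<Sum>\<^sub>\<infinity>x\<in>A. ennreal (f x)) \<le> ennreal K"
    by (rule infsum_le_finite_sums[OF nonneg_summable_on_complete]) (use f K in \<open>auto simp: ennreal_leI\<close>)
  also have "\<dots> < \<infinity>" by simp
  finally show "(\<Sum>\<^sub>\<infinity>x\<in>A. ennreal (f x)) < \<infinity>" .
qed

text \<open>Summation by parts: the sum of the weights below \<open>n\<close> is at most the weight at \<open>n\<close>.\<close>

lemma weighted_sum_le_of_differences:
  fixes N :: "nat \<Rightarrow> real" and \<kappa> :: "nat \<Rightarrow> 'b :: real_normed_vector"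
  assumes N: "\<And>n. 0 \<le> N n" "\<And>n. 2 * N n \<le> N (Suc n)"
    and A: "\<And>m. (\<Sum>j<m. N (Suc j) * norm (\<kappa> (Suc j) - \<kappa> j)) \<le> A"
    and lim: "\<kappa> \<longlonglongrightarrow> 0"
  shows "(\<Sum>n<M. N n * norm (\<kappa> n)) \<le> A"
proof -
  define D where "D j = norm (\<kappa> (Suc j) - \<kappa> j)" for j
  define P where "P m = (\<Sum>n<m. N n)" for m
  have P: "P m \<le> N m" for m
  proof (induction m)
    case (Suc m)
    then show ?case using N(2)[of m] by (simp add: P_def)
  qed (use N in \<open>simp add: P_def\<close>)
  have P0: "0 \<le> P m" for m unfolding P_def using N(1) by (intro sum_nonneg) auto
  have tri: "norm (\<kappa> m) \<le> norm (\<kappa> (Suc m)) + D m" for m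
    using norm_triangle_sub[of "\<kappa> m" "\<kappa> (Suc m)"] by (simp add: D_def norm_minus_commute)
  have shift: "c * norm (\<kappa> m) \<le> c * norm (\<kappa> (Suc m)) + N (Suc m) * D m"
    if "0 \<le> c" "c \<le> N (Suc m)" for c m
  proof -
    have "c * norm (\<kappa> m) \<le> c * (norm (\<kappa> (Suc m)) + D m)"
      using tri that by (intro mult_left_mono) auto
    moreover have "c * D m \<le> N (Suc m) * D m"
      using that by (intro mult_right_mono) (auto simp: D_def)
    ultimately show ?thesis by (simp add: distrib_left)
  qed
  have base: "(\<Sum>n<M. N n * norm (\<kappa> n)) \<le> P M * norm (\<kappa> M) + (\<Sum>j<M. N (Suc j) * D j)"
  proof (induction M)
    case (Suc M)
    have "P (Suc M) * norm (\<kappa> M) = P M * norm (\<kappa> M) + N M * norm (\<kappa> M)"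
      by (simp add: P_def distrib_right)
    with Suc shift[OF P0[of "Suc M"] P[of "Suc M"]] show ?case by simp
  qed (simp add: P_def)
  have le: "(\<Sum>n<M. N n * norm (\<kappa> n)) \<le> P M * norm (\<kappa> m) + A" if "M \<le> m" for m
  proof -
    have "(\<Sum>n<M. N n * norm (\<kappa> n)) \<le> P M * norm (\<kappa> m) + (\<Sum>j<m. N (Suc j) * D j)"
      using that
    proof (induction m rule: dec_induct)
      case (step m)
      have "N m \<le> N (Suc m)" "N M \<le> N m"
        using N lift_Suc_mono_le[of N M m] step.hyps by (smt (verit))+
      with P[of M] have "P M \<le> N (Suc m)" by linarith
      from shift[OF P0 this]
      show ?case using step.IH by simp
    qed (rule base)
    with A[of m] show ?thesis by (simp add: D_def)
  qed
  have "(\<lambda>m. P M * norm (\<kappa> m) + A) \<longlonglongrightarrow> P M * 0 + A"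
    by (intro tendsto_intros tendsto_norm_zero lim)
  from LIMSEQ_le_const[OF this] show ?thesis using le by auto
qed

lemma sum_cmod_le_1_of_supported:
  assumes B: "finite B" "{x. a x \<noteq> 0} \<subseteq> B" and norm: "L2_norm a \<le> mu B powr (-1/2)"
    and F: "finite F"
  shows "(\<Sum>x\<in>F. cmod (a x)) \<le> 1"
proof (cases "B = {}")
  case False
  have B0: "0 < real (card B)" using False B by (simp add: card_gt_0_iff)
  have "(\<Sum>x\<in>F. cmod (a x)) = (\<Sum>x\<in>F \<inter> B. cmod (a x))"
    using B F by (intro sum.mono_neutral_right) auto
  also have "\<dots> \<le> (\<Sum>x\<in>B. cmod (a x))" using B by (intro sum_mono2) auto
  finally have le: "(\<Sum>x\<in>F. cmod (a x)) \<le> (\<Sum>x\<in>B. cmod (a x))" .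
  have "(\<Sum>\<^sub>\<infinity>x. (cmod (a x))\<^sup>2) = (\<Sum>\<^sub>\<infinity>x\<in>B. (cmod (a x))\<^sup>2)"
    using B by (intro infsum_cong_neutral) auto
  then have L2: "(L2_norm a)\<^sup>2 = (\<Sum>x\<in>B. (cmod (a x))\<^sup>2)"
    using B by (simp add: L2_norm_def sum_nonneg)
  have "(\<Sum>x\<in>B. cmod (a x))\<^sup>2 \<le> (\<Sum>x\<in>B. (cmod (a x))\<^sup>2) * card B"
    by (rule sum_squared_le_sum_of_squares)
  also have "(\<Sum>x\<in>B. (cmod (a x))\<^sup>2) \<le> (mu B powr (-1/2))\<^sup>2"
    unfolding L2[symmetric] using norm by (intro power_mono) (auto simp: L2_norm_def infsum_nonneg)
  also have "(mu B powr (-1/2))\<^sup>2 = 1 / card B"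
    using B B0 by (simp add: mu_def powr_minus powr_half_sqrt power_inverse inverse_eq_divide power_divide)
  finally have "(\<Sum>x\<in>B. cmod (a x))\<^sup>2 \<le> 1\<^sup>2" using B0 by (simp add: mult_right_mono)
  then have "(\<Sum>x\<in>B. cmod (a x)) \<le> 1" by (rule power2_le_imp_le) simp
  with le show ?thesis by linarith
qed (use B in auto)

lemma has_sum_finite_sum:
  fixes f :: "'i \<Rightarrow> 'a \<Rightarrow> 'b :: {topological_comm_monoid_add}"
  assumes "\<And>i. i \<in> I \<Longrightarrow> (f i has_sum s i) A"
  shows "((\<lambda>x. \<Sum>i\<in>I. f i x) has_sum (\<Sum>i\<in>I. s i)) A"
  using assms by (induction I rule: infinite_finite_induct) (auto intro: has_sum_add)

lemma L1_boundI:
  fixes f :: "'a \<Rightarrow> complex"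
  assumes "\<And>F. finite F \<Longrightarrow> (\<Sum>x\<in>F. cmod (f x)) \<le> B"
  shows "f \<in> L1" "L1_norm f \<le> B"
proof -
  have *: "(\<lambda>x. cmod (f x)) summable_on UNIV"
    by (rule nonneg_bdd_above_summable_on) (auto intro!: bdd_aboveI[where M = B] assms)
  then show "f \<in> L1" by (simp add: L1_def)
  show "L1_norm f \<le> B" unfolding L1_norm_def
    by (rule infsum_le_finite_sums[OF *]) (use assms in auto)
qed

lemma L1_norm_nonneg: "0 \<le> L1_norm f"
  unfolding L1_norm_def by (rule infsum_nonneg) auto

lemma sum_cmod_le_L1_norm: "f \<in> L1 \<Longrightarrow> finite F \<Longrightarrow> (\<Sum>x\<in>F. cmod (f x)) \<le> L1_norm f"
  unfolding L1_norm_def L1_def by (rule finite_sum_le_infsum) auto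

lemma atomic_norm_nonneg: "0 \<le> atomic_norm atom f" if "f \<in> atomic_space atom"
  unfolding atomic_norm_def
proof (rule cInf_greatest)
  show "{\<Sum>j. cmod (c j) |c a. atomic_decomposition atom f c a} \<noteq> {}"
    using that by (auto simp: atomic_space_def)
qed (auto simp: atomic_decomposition_def intro!: suminf_nonneg)

lemma atomic_space_mono:
  assumes "\<And>a. atom a \<Longrightarrow> atom' a"
  shows "atomic_space atom \<subseteq> atomic_space atom'"
  using assms unfolding atomic_space_def atomic_decomposition_def by blast

lemma atomic_norm_antimono:
  assumes "\<And>a. atom a \<Longrightarrow> atom' a" "f \<in> atomic_space atom"
  shows "atomic_norm atom' f \<le> atomic_norm atom f"
  unfolding atomic_norm_def
proof (rule cInf_superset_mono)
  show "{\<Sum>j. cmod (c j) |c a. atomic_decomposition atom f c a} \<noteq> {}"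
    using assms(2) by (auto simp: atomic_space_def)
  show "bdd_below {\<Sum>j. cmod (c j) |c a. atomic_decomposition atom' f c a}"
    by (rule bdd_belowI[where m = 0]) (auto simp: atomic_decomposition_def intro!: suminf_nonneg)
  show "{\<Sum>j. cmod (c j) |c a. atomic_decomposition atom f c a}
      \<subseteq> {\<Sum>j. cmod (c j) |c a. atomic_decomposition atom' f c a}"
    using assms(1) unfolding atomic_decomposition_def by blast
qed

lemma extends_bounded_to_L1_subspace:
  assumes ext: "extends_bounded_to_L1 X N T" and "Y \<subseteq> X"
    and N: "\<And>f. f \<in> Y \<Longrightarrow> 0 \<le> N f \<and> N f \<le> M f"
  shows "extends_bounded_to_L1 Y M T"
proof -
  obtain S C where S: "linear_operator_on X S" "\<forall>f\<in>X \<inter> finsupp. S f = T f"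
      "\<forall>f\<in>X. S f \<in> L1 \<and> L1_norm (S f) \<le> C * N f"
    using ext unfolding extends_bounded_to_L1_def by blast
  have "S f \<in> L1 \<and> L1_norm (S f) \<le> \<bar>C\<bar> * M f" if "f \<in> Y" for f
  proof -
    have "C * N f \<le> \<bar>C\<bar> * N f" using N[OF that] by (intro mult_right_mono) auto
    also have "\<dots> \<le> \<bar>C\<bar> * M f" using N[OF that] by (intro mult_left_mono) auto
    finally show ?thesis using S(3) that \<open>Y \<subseteq> X\<close> by fastforce
  qed
  moreover have "linear_operator_on Y S"
    using S(1) \<open>Y \<subseteq> X\<close> unfolding linear_operator_on_def by blast
  ultimately show ?thesis using S(2) \<open>Y \<subseteq> X\<close> unfolding extends_bounded_to_L1_def by blast
qed

lemma atomic_space_L1_bound: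
  assumes atoms: "\<And>a F. atom a \<Longrightarrow> finite F \<Longrightarrow> (\<Sum>x\<in>F. cmod (a x)) \<le> 1"
    and f: "f \<in> atomic_space atom"
  shows "f \<in> L1" "L1_norm f \<le> atomic_norm atom f"
proof -
  have main: "(\<Sum>x\<in>F. cmod (f x)) \<le> (\<Sum>j. cmod (c j))"
    if "atomic_decomposition atom f c a" "finite F" for c a F
  proof -
    from that have at: "\<And>j. atom (a j)" and c: "summable (\<lambda>j. cmod (c j))"
      and s: "\<And>x. (\<lambda>j. c j * a j x) sums f x"
      by (auto simp: atomic_decomposition_def)
    have le1: "cmod (a j x) \<le> 1" for j x using atoms[OF at, of "{x}"] by simp
    have sm: "summable (\<lambda>j. cmod (c j) * cmod (a j x))" for x
      by (rule summable_comparison_test'[OF c, of 0]) (simp add: le1 mult_left_le)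
    have "cmod (f x) \<le> (\<Sum>j. cmod (c j) * cmod (a j x))" for x
      using summable_norm[of "\<lambda>j. c j * a j x"] sm[of x] s[of x]
      by (simp add: norm_mult sums_iff)
    then have "(\<Sum>x\<in>F. cmod (f x)) \<le> (\<Sum>x\<in>F. \<Sum>j. cmod (c j) * cmod (a j x))"
      by (intro sum_mono)
    also have "\<dots> = (\<Sum>j. \<Sum>x\<in>F. cmod (c j) * cmod (a j x))"
      by (rule suminf_sum[symmetric]) (rule sm)
    also have "\<dots> \<le> (\<Sum>j. cmod (c j))"
    proof (rule suminf_le)
      show "(\<Sum>x\<in>F. cmod (c j) * cmod (a j x)) \<le> cmod (c j)" for j
        using mult_left_mono[OF atoms[OF at[of j] that(2)], of "cmod (c j)"]
        by (simp add: sum_distrib_left)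
    qed (auto intro!: summable_sum sm c)
    finally show ?thesis .
  qed
  from f obtain c a where ca: "atomic_decomposition atom f c a"
    by (auto simp: atomic_space_def)
  show "f \<in> L1" using L1_boundI(1) main[OF ca] by blast
  show "L1_norm f \<le> atomic_norm atom f"
    unfolding atomic_norm_def using ca main
    by (intro cInf_greatest) (auto intro!: L1_boundI(2))
qed

lemma extends_bounded_to_L1_schur:
  fixes k :: "'a \<Rightarrow> 'a \<Rightarrow> complex"
  assumes k: "is_kernel T k"
    and K: "\<And>F y. finite F \<Longrightarrow> (\<Sum>x\<in>F. cmod (k x y)) \<le> K"
  shows "extends_bounded_to_L1 L1 L1_norm T"
proof -
  define S where "S f x = (\<Sum>\<^sub>\<infinity>y. k x y * f y)" for f x
  have kK: "cmod (k x y) \<le> K" for x y using K[of "{x}" y] by simp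
  have sm: "(\<lambda>y. cmod (k x y) * cmod (f y)) summable_on UNIV" if "f \<in> L1" for f x
  proof (rule summable_on_comparison_test)
    show "(\<lambda>y. K * cmod (f y)) summable_on UNIV"
      using that by (intro summable_on_cmult_right) (simp add: L1_def)
  qed (auto intro!: mult_right_mono kK)
  have sm': "(\<lambda>y. k x y * f y) summable_on UNIV" if "f \<in> L1" for f x
    by (rule abs_summable_summable) (use sm[OF that] in \<open>simp add: norm_mult\<close>)
  have "linear_operator_on L1 S"
    unfolding linear_operator_on_def S_def
    by (auto simp: distrib_left infsum_add sm' mult.left_commute infsum_cmult_right)
  moreover have "S f = T f" if "f \<in> finsupp" for f
  proof
    fix x
    have "S f x = (\<Sum>\<^sub>\<infinity>y\<in>{y. f y \<noteq> 0}. k x y * f y)"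
      unfolding S_def by (rule infsum_cong_neutral) auto
    also have "\<dots> = T f x" using that k by (simp add: is_kernel_def finsupp_def)
    finally show "S f x = T f x" .
  qed
  moreover have "(\<Sum>x\<in>F. cmod (S f x)) \<le> K * L1_norm f" if f: "f \<in> L1" and "finite F" for f F
  proof -
    have "(\<Sum>x\<in>F. cmod (S f x)) \<le> (\<Sum>x\<in>F. \<Sum>\<^sub>\<infinity>y. cmod (k x y) * cmod (f y))"
    proof (rule sum_mono)
      fix x
      show "cmod (S f x) \<le> (\<Sum>\<^sub>\<infinity>y. cmod (k x y) * cmod (f y))"
        using norm_infsum_bound[of "\<lambda>y. k x y * f y" UNIV] sm[OF f, of x]
        by (simp add: S_def norm_mult)
    qed
    also have "\<dots> = (\<Sum>\<^sub>\<infinity>y. \<Sum>x\<in>F. cmod (k x y) * cmod (f y))"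
      by (rule infsumI[symmetric], rule has_sum_finite_sum) (simp_all add: sm[OF f])
    also have "\<dots> \<le> (\<Sum>\<^sub>\<infinity>y. K * cmod (f y))"
    proof (rule infsum_mono)
      show "(\<lambda>y. K * cmod (f y)) summable_on UNIV"
        using f by (intro summable_on_cmult_right) (simp add: L1_def)
      show "(\<lambda>y. \<Sum>x\<in>F. cmod (k x y) * cmod (f y)) summable_on UNIV"
        by (rule has_sum_imp_summable, rule has_sum_finite_sum) (rule has_sum_infsum[OF sm[OF f]])
      show "(\<Sum>x\<in>F. cmod (k x y) * cmod (f y)) \<le> K * cmod (f y)" for y
        using mult_right_mono[OF K[OF \<open>finite F\<close>, of y], of "cmod (f y)"]
        by (simp add: sum_distrib_right)
    qed
    also have "\<dots> = K * L1_norm f"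
      using f by (simp add: L1_norm_def L1_def infsum_cmult_right)
    finally show ?thesis .
  qed
  then have "\<forall>f\<in>L1. S f \<in> L1 \<and> L1_norm (S f) \<le> K * L1_norm f"
    by (auto intro!: L1_boundI)
  ultimately show ?thesis
    unfolding extends_bounded_to_L1_def by (intro exI[of _ S] conjI exI[of _ K]) auto
qed

section \<open>Distances and isometries in a homogeneous tree\<close>

locale htree =
  fixes adj :: "'a \<Rightarrow> 'a \<Rightarrow> bool" and q :: nat
  assumes homogeneous_tree: "homogeneous_tree adj q"
begin

abbreviation d where "d \<equiv> graph_dist adj"

lemma adj_sym: "adj x y \<Longrightarrow> adj y x"
  and adj_irrefl: "\<not> adj x x"
  and adj_connected: "adj\<^sup>*\<^sup>* x y"
  and no_cycle: "\<not> graph_cycle adj xs"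
  and card_adj: "card {y. adj x y} = q + 1"
  and finite_adj: "finite {y. adj x y}"
proof -
  have *: "card {y. adj x y} = q + 1" for x
    using homogeneous_tree by (auto simp: homogeneous_tree_def)
  show "card {y. adj x y} = q + 1" by (rule *)
  show "finite {y. adj x y}" by (rule card_ge_0_finite) (simp add: *)
qed (use homogeneous_tree in \<open>auto simp: homogeneous_tree_def symp_def irreflp_def\<close>)

lemma relpowp_dist: "(adj ^^ d x y) x y"
  unfolding graph_dist_def by (rule LeastI_ex) (use adj_connected rtranclp_power in metis)

lemma dist_le: "(adj ^^ n) x y \<Longrightarrow> d x y \<le> n"
  unfolding graph_dist_def by (rule Least_le)

lemma dist_self [simp]: "d x x = 0"
  using dist_le[of 0 x x] by simp

lemma dist_eq_0_iff [simp]: "d x y = 0 \<longleftrightarrow> x = y"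
  using relpowp_dist[of x y] by (cases "d x y = 0") auto

lemma relpowp_sym: "(adj ^^ n) x y \<Longrightarrow> (adj ^^ n) y x"
proof (induction n arbitrary: y)
  case (Suc n)
  then obtain u where "(adj ^^ n) x u" "adj u y" by auto
  with Suc.IH[of u] show ?case using relpowp_Suc_I2[of adj y u n x] adj_sym by blast
qed auto

lemma dist_sym: "d x y = d y x"
  by (rule antisym; rule dist_le, rule relpowp_sym, rule relpowp_dist)

lemma dist_triangle: "d x z \<le> d x y + d y z"
  by (rule dist_le) (auto simp: relpowp_add intro: relpowp_dist)

lemma dist_adj: "adj x y \<Longrightarrow> d x y = 1"
proof -
  assume *: "adj x y"
  then have "d x y \<le> 1" by (intro dist_le) auto
  moreover have "d x y \<noteq> 0" using * adj_irrefl by auto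
  ultimately show ?thesis by linarith
qed

lemma closer_neighbour:
  assumes "d r z = Suc n"
  obtains w where "adj w z" "d r w = n"
proof -
  have "(adj ^^ Suc n) r z" using relpowp_dist[of r z] assms by simp
  then obtain w where w: "(adj ^^ n) r w" "adj w z" by auto
  then have "d r w \<le> n" "d r z \<le> d r w + 1"
    using dist_le dist_triangle[of r z w] dist_adj by auto
  with w(2) assms show ?thesis by (intro that) auto
qed

lemma geodesic:
  obtains p where "p (0::nat) = r" "p (d r w) = w" "\<And>i. i < d r w \<Longrightarrow> adj (p i) (p (Suc i))"
    "\<And>i. i \<le> d r w \<Longrightarrow> d r (p i) = i"
proof -
  have "\<exists>p. p (0::nat) = r \<and> p n = w \<and> (\<forall>i<n. adj (p i) (p (Suc i))) \<and> (\<forall>i\<le>n. d r (p i) = i)"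
    if "d r w = n" for n using that
  proof (induction n arbitrary: w)
    case 0
    then show ?case by (intro exI[of _ "\<lambda>_. r"]) auto
  next
    case (Suc n)
    from closer_neighbour[OF Suc.prems] obtain u where u: "adj u w" "d r u = n" by blast
    from Suc.IH[OF u(2)] obtain p where p: "p 0 = r" "p n = u"
      "\<forall>i<n. adj (p i) (p (Suc i))" "\<forall>i\<le>n. d r (p i) = i" by blast
    show ?case
      by (rule exI[of _ "p(Suc n := w)"]) (use p u Suc.prems in \<open>auto simp: less_Suc_eq le_Suc_eq\<close>)
  qed
  then show ?thesis using that by blast
qed

text \<open>A closed walk without backtracking contains a shortest one, and that is a cycle.\<close>

lemma nonbacktracking_inj:
  fixes p :: "nat \<Rightarrow> 'a"
  assumes step: "\<And>i. i < m \<Longrightarrow> adj (p i) (p (Suc i))"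
    and nb: "\<And>i. i + 2 \<le> m \<Longrightarrow> p i \<noteq> p (i + 2)"
  shows "i < j \<Longrightarrow> j \<le> m \<Longrightarrow> p i \<noteq> p j"
proof (induction "j - i" arbitrary: i j rule: less_induct)
  case less
  show ?case
  proof
    assume eq: "p i = p j"
    have "j \<noteq> Suc i" using step[of i] adj_irrefl less.prems eq by auto
    moreover have "j \<noteq> i + 2" using nb[of i] less.prems eq by auto
    ultimately have j: "i + 3 \<le> j" using less.prems by auto
    have inj: "p a \<noteq> p b" if "i \<le> a" "a < b" "b < j" for a b
      using less.hyps[of b a] that less.prems by auto
    have "distinct (map p [i..<j])"
      by (auto simp: distinct_map inj_on_def) (metis inj linorder_neqE_nat)
    moreover have "successively adj (map p [i..<j])"
      using less.prems by (auto simp: successively_conv_nth intro: step)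
    moreover have "adj (last (map p [i..<j])) (hd (map p [i..<j]))"
      using step[of "j - 1"] j less.prems eq by (auto simp: last_map hd_map)
    ultimately have "graph_cycle adj (map p [i..<j])" using j by (auto simp: graph_cycle_def)
    then show False using no_cycle by blast
  qed
qed

lemma no_horizontal_edge:
  assumes "adj y z" shows "d r y \<noteq> d r z"
proof
  assume eq: "d r y = d r z"
  define n where "n = d r y"
  from geodesic[of r y] obtain a where a: "a 0 = r" "a n = y"
    "\<And>i. i < n \<Longrightarrow> adj (a i) (a (Suc i))" "\<And>i. i \<le> n \<Longrightarrow> d r (a i) = i" unfolding n_def by metis
  from geodesic[of r z] obtain b where b: "b 0 = r" "b n = z"
    "\<And>i. i < n \<Longrightarrow> adj (b i) (b (Suc i))" "\<And>i. i \<le> n \<Longrightarrow> d r (b i) = i" unfolding n_def eq by metis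
  define p where "p i = (if i \<le> n then a i else b (2 * n + 1 - i))" for i
  have lev: "d r (p i) = (if i \<le> n then i else 2 * n + 1 - i)" if "i \<le> 2 * n + 1" for i
    using that a(4) b(4) by (auto simp: p_def)
  have "p 0 \<noteq> p (2 * n + 1)"
  proof (rule nonbacktracking_inj[of "2 * n + 1"])
    fix i assume i: "i < 2 * n + 1"
    consider "i < n" | "i = n" | "n < i" by linarith
    then show "adj (p i) (p (Suc i))"
    proof cases
      case 3
      then have "adj (b (Suc (2 * n - i))) (b (2 * n - i))"
        using i by (intro adj_sym[OF b(3)]) auto
      with 3 i show ?thesis by (simp add: p_def Suc_diff_le)
    qed (use assms a b in \<open>auto simp: p_def\<close>)
  next
    fix i assume "i + 2 \<le> 2 * n + 1"
    then have "d r (p i) \<noteq> d r (p (i + 2))" by (auto simp: lev) presburger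
    then show "p i \<noteq> p (i + 2)" by auto
  qed auto
  then show False using a(1) b(1) by (simp add: p_def)
qed

lemma unique_parent:
  assumes "adj y x" "adj z x" "d r x = Suc (d r y)" "d r x = Suc (d r z)"
  shows "y = z"
proof (rule ccontr)
  assume "y \<noteq> z"
  define n where "n = d r y"
  have nz: "n = d r z" using assms n_def by simp
  from geodesic[of r y] obtain a where a: "a 0 = r" "a n = y"
    "\<And>i. i < n \<Longrightarrow> adj (a i) (a (Suc i))" "\<And>i. i \<le> n \<Longrightarrow> d r (a i) = i" unfolding n_def by metis
  from geodesic[of r z] obtain b where b: "b 0 = r" "b n = z"
    "\<And>i. i < n \<Longrightarrow> adj (b i) (b (Suc i))" "\<And>i. i \<le> n \<Longrightarrow> d r (b i) = i" unfolding nz by metis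
  define p where "p i = (if i \<le> n then a i else if i = n + 1 then x else b (2 * n + 2 - i))" for i
  have lev: "d r (p i) = (if i \<le> n + 1 then i else 2 * n + 2 - i)" if "i \<le> 2 * n + 2" for i
    using that a(4) b(4) assms(3) by (auto simp: p_def n_def)
  have "p 0 \<noteq> p (2 * n + 2)"
  proof (rule nonbacktracking_inj[of "2 * n + 2"])
    fix i assume i: "i < 2 * n + 2"
    consider "i < n" | "i = n" | "i = n + 1" | "n + 1 < i" by linarith
    then show "adj (p i) (p (Suc i))"
    proof cases
      case 4
      then have "adj (b (Suc (2 * n + 1 - i))) (b (2 * n + 1 - i))"
        using i by (intro adj_sym[OF b(3)]) auto
      with 4 i show ?thesis by (simp add: p_def Suc_diff_le)
    qed (use assms a b adj_sym in \<open>auto simp: p_def\<close>)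
  next
    fix i assume i: "i + 2 \<le> 2 * n + 2"
    show "p i \<noteq> p (i + 2)"
    proof (cases "i = n")
      case True
      then show ?thesis using a b \<open>y \<noteq> z\<close> by (simp add: p_def)
    next
      case False
      then have "d r (p i) \<noteq> d r (p (i + 2))" using i by (auto simp: lev)
      then show ?thesis by auto
    qed
  qed auto
  then show False using a(1) b(1) by (simp add: p_def)
qed

definition children where "children r w = {z. adj w z \<and> d r z = Suc (d r w)}"

lemma adj_cases:
  assumes "adj w z" shows "z \<in> children r w \<or> w \<in> children r z"
proof -
  have "d w z = 1" "d z w = 1" "adj z w" using assms adj_sym dist_adj by auto
  moreover have "d r w \<noteq> d r z" by (rule no_horizontal_edge[OF assms])
  ultimately have "d r z = Suc (d r w) \<or> d r w = Suc (d r z)"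
    using dist_triangle[of r z w] dist_triangle[of r w z] by linarith
  with assms \<open>adj z w\<close> show ?thesis by (auto simp: children_def)
qed

lemma finite_children: "finite (children r w)"
  by (rule finite_subset[OF _ finite_adj[of w]]) (auto simp: children_def)

lemma children_inj: "z \<in> children r w \<Longrightarrow> z \<in> children r w' \<Longrightarrow> w = w'"
  using unique_parent[of w z w' r] by (auto simp: children_def)

lemma ex_parent:
  assumes "z \<noteq> r" obtains w where "z \<in> children r w" "d r z = Suc (d r w)"
proof -
  from assms obtain n where "d r z = Suc n"
    by (metis dist_eq_0_iff not0_implies_Suc)
  from closer_neighbour[OF this] this that show ?thesis by (auto simp: children_def)
qed

lemma card_children: "card (children r w) = (if w = r then q + 1 else q)"
proof (cases "w = r")
  case True
  have "children r r = {y. adj r y}" using dist_adj by (auto simp: children_def)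
  then show ?thesis using True card_adj by simp
next
  case False
  then obtain u where u: "w \<in> children r u" using ex_parent by blast
  have "{y. adj w y} = insert u (children r w)"
  proof (intro set_eqI iffI)
    fix y assume "y \<in> {y. adj w y}"
    then show "y \<in> insert u (children r w)"
      using adj_cases[of w y r] children_inj[OF u, of y] by auto
  next
    fix y assume "y \<in> insert u (children r w)"
    then show "y \<in> {y. adj w y}" using u adj_sym[of u w] by (auto simp: children_def)
  qed
  moreover have "u \<notin> children r w" using u by (auto simp: children_def)
  ultimately show ?thesis using card_adj[of w] False finite_children by simp
qed

lemma sphere_Suc: "{x. d r x = Suc n} = (\<Union>w\<in>{x. d r x = n}. children r w)"
proof (intro set_eqI iffI)
  fix z assume "z \<in> {x. d r x = Suc n}"
  then show "z \<in> (\<Union>w\<in>{x. d r x = n}. children r w)"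
    using closer_neighbour[of r z n] by (auto simp: children_def)
qed (auto simp: children_def)

lemma finite_sphere: "finite {x. d r x = n}"
proof (induction n)
  case (Suc n)
  then show ?case unfolding sphere_Suc by (auto intro: finite_children)
qed auto

lemma finite_ball: "finite {x. d r x \<le> n}"
proof -
  have "{x. d r x \<le> n} = (\<Union>m\<le>n. {x. d r x = m})" by auto
  then show ?thesis using finite_sphere by simp
qed

lemma card_sphere_Suc: "2 * card {x. d r x = n} \<le> card {x. d r x = Suc n}" if "2 \<le> q"
proof -
  have "card {x. d r x = Suc n} = (\<Sum>w\<in>{x. d r x = n}. card (children r w))"
    unfolding sphere_Suc
    by (rule card_UN_disjoint) (use finite_sphere finite_children children_inj in auto)
  also have "\<dots> \<ge> (\<Sum>w\<in>{x. d r x = n}. 2)"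
    by (rule sum_mono) (use that in \<open>auto simp: card_children\<close>)
  finally show ?thesis by simp
qed

definition segment where "segment r x = {z. d r z + d z x = d r x}"

lemma card_children_segment:
  "card (children r w \<inter> segment r x) = (if w \<in> segment r x \<and> d r w < d r x then 1 else 0)"
proof (cases "w \<in> segment r x \<and> d r w < d r x")
  case True
  then have seg: "d r w + d w x = d r x" by (simp add: segment_def)
  with True obtain m where m: "d x w = Suc m"
    by (metis add.right_neutral dist_sym less_irrefl not0_implies_Suc)
  from closer_neighbour[OF this] obtain u where u: "adj u w" "d x u = m" by blast
  have sym: "d u x = m" "d w x = Suc m" "d w u = 1" "d u w = 1"
    using m u dist_sym dist_adj by metis+
  have ru: "d r u = Suc (d r w)"
    using dist_triangle[of r x u] dist_triangle[of r u w] sym seg by linarith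
  have "children r w \<inter> segment r x = {u}"
  proof (intro set_eqI iffI)
    fix z assume "z \<in> children r w \<inter> segment r x"
    then have z: "adj w z" "d r z = Suc (d r w)" "d r z + d z x = d r x"
      by (auto simp: children_def segment_def)
    then have "d x w = Suc (d x z)" using seg sym m dist_sym[of x z] by linarith
    then show "z \<in> {u}" using unique_parent[of u w z x] u z(1) m adj_sym by auto
  next
    fix z assume "z \<in> {u}"
    then show "z \<in> children r w \<inter> segment r x"
      using u adj_sym ru sym seg by (auto simp: children_def segment_def)
  qed
  with True show ?thesis by simp
next
  case False
  have "z \<notin> segment r x" if "z \<in> children r w" for z
  proof
    assume "z \<in> segment r x"
    then have "d r z + d z x = d r x" "d r z = Suc (d r w)" "d w z = 1"
      using that dist_adj by (auto simp: children_def segment_def)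
    then have "d r w + d w x = d r x" "d r w < d r x"
      using dist_triangle[of w x z] dist_triangle[of r x w] by linarith+
    with False show False by (simp add: segment_def)
  qed
  then have "children r w \<inter> segment r x = {}" by blast
  with False show ?thesis by auto
qed

text \<open>An isometry is built level by level from the root, choosing bijections between the children
  of a vertex and of its image; the segments are marked so that \<open>x\<close> is sent to \<open>x'\<close>.\<close>

lemma ex_isometry:
  assumes dist_eq: "d r x = d r' x'"
  obtains g where "g \<in> isometries adj" "g r = r'" "g x = x'"
proof -
  define good where "good w w' b \<longleftrightarrow> bij_betw b (children r w) (children r' w') \<and>
    (\<forall>z\<in>children r w. b z \<in> segment r' x' \<longleftrightarrow> z \<in> segment r x)" for w w' b
  define \<beta> where "\<beta> w w' = (SOME b. good w w' b)" for w w'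
  define par where "par z = (THE w. z \<in> children r w)" for z
  define F where "F = rec_nat (\<lambda>_. r') (\<lambda>_ f z. \<beta> (par z) (f (par z)) z)"
  define g where "g z = F (d r z) z" for z
  have par: "par z = w" if "z \<in> children r w" for z w
    unfolding par_def using that children_inj by (intro the_equality) auto
  have gr: "g r = r'" by (simp add: g_def F_def)
  have g_child: "g z = \<beta> w (g w) z" if "z \<in> children r w" for z w
    using that par[OF that] by (simp add: g_def F_def children_def)
  have good: "good w w' (\<beta> w w')"
    if "d r w = d r' w'" "w \<in> segment r x \<longleftrightarrow> w' \<in> segment r' x'" for w w'
  proof -
    have "w = r \<longleftrightarrow> w' = r'" using that(1) by (metis dist_eq_0_iff)
    then have "\<exists>b. good w w' b"
      unfolding good_def using that dist_eq
      by (intro bij_betw_marked) (auto simp: finite_children card_children card_children_segment)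
    then show ?thesis unfolding \<beta>_def by (rule someI_ex)
  qed
  have inv: "d r' (g z) = d r z \<and> (g z \<in> segment r' x' \<longleftrightarrow> z \<in> segment r x)" for z
  proof (induction "d r z" arbitrary: z)
    case 0
    then show ?case using gr dist_eq by (auto simp: segment_def)
  next
    case (Suc n)
    then have "z \<noteq> r" by auto
    then obtain w where w: "z \<in> children r w" "d r z = Suc (d r w)" by (rule ex_parent)
    with Suc.hyps have IH: "d r' (g w) = d r w" "g w \<in> segment r' x' \<longleftrightarrow> w \<in> segment r x"
      by auto
    have gd: "good w (g w) (\<beta> w (g w))" using good[of w "g w"] IH by auto
    then have "g z \<in> children r' (g w)"
      using w(1) g_child[OF w(1)] by (auto simp: good_def bij_betw_def)
    then have "d r' (g z) = d r z" using IH w by (simp add: children_def)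
    moreover have "g z \<in> segment r' x' \<longleftrightarrow> z \<in> segment r x"
      using gd w(1) g_child[OF w(1)] by (auto simp: good_def)
    ultimately show ?case by blast
  qed
  have g_bij: "bij_betw g (children r w) (children r' (g w))" for w
  proof -
    have "bij_betw (\<beta> w (g w)) (children r w) (children r' (g w))"
      using good[of w "g w"] inv[of w] by (auto simp: good_def)
    then show ?thesis by (rule bij_betw_cong[THEN iffD2, rotated]) (rule g_child)
  qed
  have g_mem: "g z \<in> children r' (g w)" if "z \<in> children r w" for z w
    using g_bij[of w] that by (auto simp: bij_betw_def)
  have inj: "z1 = z2" if "g z1 = g z2" for z1 z2
    using that
  proof (induction "d r z1" arbitrary: z1 z2)
    case 0
    then have "d r z2 = 0" using inv[of z1] inv[of z2] by simp
    with 0 show ?case by simp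
  next
    case (Suc n)
    have "d r z2 = Suc n" using Suc inv[of z1] inv[of z2] by simp
    then have "z1 \<noteq> r" "z2 \<noteq> r" using Suc.hyps(2) by auto
    then obtain w1 w2 where w: "z1 \<in> children r w1" "d r z1 = Suc (d r w1)" "z2 \<in> children r w2"
      using ex_parent by metis
    then have "g w1 = g w2" using g_mem[OF w(1)] g_mem[OF w(3)] Suc.prems children_inj by simp
    then have "w1 = w2" using Suc.hyps w by auto
    then show ?case using w g_bij[of w1] Suc.prems by (auto simp: bij_betw_def inj_on_def)
  qed
  have surj: "\<exists>z. g z = u" for u
  proof (induction "d r' u" arbitrary: u)
    case 0
    then show ?case using gr by auto
  next
    case (Suc n)
    then have "u \<noteq> r'" by auto
    then obtain w' where w': "u \<in> children r' w'" "d r' u = Suc (d r' w')" by (rule ex_parent)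
    then obtain w where "g w = w'" using Suc.hyps by auto
    then have "u \<in> g ` children r w" using w' g_bij[of w] by (simp add: bij_betw_def)
    then show ?case by blast
  qed
  have adj_iff: "adj (g w) (g z) \<longleftrightarrow> adj w z" for w z
  proof -
    have fwd: "adj (g a) (g b)" if "b \<in> children r a" for a b
      using g_mem[OF that] by (simp add: children_def)
    have bwd: "adj a b" if "g b \<in> children r' (g a)" for a b
    proof -
      have "g b \<in> g ` children r a" using that g_bij[of a] by (simp add: bij_betw_def)
      then obtain b' where b': "b' \<in> children r a" "g b = g b'" by blast
      from inj[OF b'(2)] b'(1) show ?thesis by (simp add: children_def)
    qed
    show ?thesis
      using fwd bwd adj_cases[of w z r] adj_cases[of "g w" "g z" r'] adj_sym by metis
  qed
  have pow_iff: "(adj ^^ n) (g a) (g b) \<longleftrightarrow> (adj ^^ n) a b" for n a b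
  proof (induction n arbitrary: b)
    case 0
    show ?case using inj[of a b] by auto
  next
    case (Suc n)
    show ?case
    proof
      assume "(adj ^^ Suc n) (g a) (g b)"
      then obtain u where "(adj ^^ n) (g a) u" "adj u (g b)" by auto
      moreover obtain c where "g c = u" using surj by blast
      ultimately show "(adj ^^ Suc n) a b" using Suc.IH[of c] adj_iff[of c b] by auto
    next
      assume "(adj ^^ Suc n) a b"
      then obtain c where "(adj ^^ n) a c" "adj c b" by auto
      then show "(adj ^^ Suc n) (g a) (g b)" using Suc.IH[of c] adj_iff[of c b] by auto
    qed
  qed
  have "inj g" using inj by (rule injI)
  moreover have "surj g" using surj unfolding surj_def by metis
  ultimately have "bij g" by (rule bijI)
  then have "g \<in> isometries adj"
    by (simp add: isometries_def rho_def graph_dist_def pow_iff)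
  moreover have "g x = x'"
  proof -
    have "x \<in> segment r x" by (simp add: segment_def)
    then have "g x \<in> segment r' x'" "d r' (g x) = d r' x'" using inv[of x] dist_eq by auto
    then show ?thesis by (simp add: segment_def)
  qed
  ultimately show ?thesis using that gr by blast
qed

lemma kernel_isometry:
  assumes "G_invariant adj T" "is_kernel T k" "g \<in> isometries adj"
  shows "k (g x) (g y) = k x y"
proof -
  define e where "e z = (\<lambda>u. if u = z then 1 else (0::complex))" for z :: 'a
  have g: "bij g" using assms(3) by (simp add: isometries_def)
  have supp: "{u. e z u \<noteq> 0} = {z}" for z by (auto simp: e_def)
  have e: "e z \<in> finsupp" for z by (simp add: finsupp_def supp)
  have Te: "T (e z) u = k u z" for z u
    using assms(2) e[of z] unfolding is_kernel_def by (simp add: supp) (simp add: e_def)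
  have "inv g u = y \<longleftrightarrow> u = g y" for u using bij_inv_eq_iff[OF g, of y u] by auto
  then have "e y \<circ> inv g = e (g y)" by (simp add: e_def fun_eq_iff)
  then have "T (e (g y)) = T (e y) \<circ> inv g"
    using assms(1,3) e[of y] unfolding G_invariant_def by metis
  then have "T (e (g y)) (g x) = T (e y) x" using g by (simp add: bij_is_inj)
  then show ?thesis by (simp add: Te)
qed

lemma kernel_radial:
  assumes "G_invariant adj T" "is_kernel T k" "d x y = d x' y'"
  shows "k x y = k x' y'"
  using ex_isometry[OF assms(3)] kernel_isometry[OF assms(1,2)] by metis

section \<open>Radial kernels and atoms\<close>

lemma sum_over_spheres:
  fixes f :: "nat \<Rightarrow> real"
  assumes "finite J"
  shows "(\<Sum>x | d r x \<in> J. f (d r x)) = (\<Sum>j\<in>J. real (card {x. d r x = j}) * f j)"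
proof -
  have "{x. d r x \<in> J} = (\<Union>j\<in>J. {x. d r x = j})" by auto
  then have "(\<Sum>x | d r x \<in> J. f (d r x)) = (\<Sum>j\<in>J. \<Sum>x | d r x = j. f (d r x))"
    using sum.UNION_disjoint[OF assms, of "\<lambda>j. {x. d r x = j}" "\<lambda>x. f (d r x)"] finite_sphere
    by fastforce
  then show ?thesis by simp
qed

lemma kernel_column_sums_bounded:
  assumes q: "2 \<le> q" and T: "G_invariant adj T" "is_kernel T k"
    and van: "vanishes_at_infinity (\<lambda>x. k x v)" and hor: "local_Hormander adj v k"
  shows "\<exists>K. \<forall>F y. finite F \<longrightarrow> (\<Sum>x\<in>F. cmod (k x y)) \<le> K"
proof -
  define N where "N n = real (card {x. d v x = n})" for n
  have N2: "2 * N n \<le> N (Suc n)" for n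
    using card_sphere_Suc[OF q, of v n] unfolding N_def by linarith
  have Npos: "1 \<le> N n" for n
  proof (induction n)
    case (Suc n)
    then show ?case using N2[of n] by linarith
  qed (simp add: N_def)
  have "\<exists>x. d v x = n" for n
  proof (rule ccontr)
    assume "\<nexists>x. d v x = n"
    with Npos[of n] show False by (simp add: N_def)
  qed
  then obtain p where p: "\<And>n. d v (p n) = n" by metis
  define \<kappa> where "\<kappa> n = k (p n) v" for n
  have k\<kappa>: "k x y = \<kappa> (d y x)" for x y
    unfolding \<kappa>_def using p by (intro kernel_radial[OF T]) (metis dist_sym)
  define D where "D j = cmod (\<kappa> j - \<kappa> (j - 1))" for j
  define H where "H y x = cmod (k x y - k x v)" for y x
  have "\<exists>B. \<forall>F. finite F \<longrightarrow> F \<subseteq> {x. rho adj x v \<ge> 2} \<longrightarrow> (\<Sum>x\<in>F. H y x) \<le> B"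
    if "adj y v" for y
  proof -
    have "finite {y. adj y v}" using finite_adj[of v] adj_sym by (metis (no_types, lifting) Collect_cong)
    then have "(\<Sum>\<^sub>\<infinity>x\<in>{x. rho adj x v \<ge> 2}. ennreal (H y x)) < \<infinity>"
      using hor that unfolding local_Hormander_def H_def by (subst (asm) Max_less_iff) auto
    then show ?thesis by (subst (asm) infsum_ennreal_finite_iff) (simp_all add: H_def)
  qed
  then obtain B where B: "\<And>y F. adj y v \<Longrightarrow> finite F \<Longrightarrow> F \<subseteq> {x. rho adj x v \<ge> 2} \<Longrightarrow>
      (\<Sum>x\<in>F. H y x) \<le> B y"
    by metis
  have fin: "finite {y. adj v y}" by (rule finite_adj)
  have D_le: "D (d v x) \<le> (\<Sum>y | adj v y. H y x)" if x: "1 \<le> d v x" for x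
  proof -
    have "d x v = Suc (d v x - 1)" using x dist_sym[of x v] by simp
    then obtain y where y: "adj y v" "d x y = d v x - 1" by (rule closer_neighbour)
    then have "D (d v x) = H y x"
      by (simp add: D_def H_def k\<kappa> dist_sym[of y x] norm_minus_commute)
    also have "\<dots> \<le> (\<Sum>y | adj v y. H y x)"
      using y adj_sym fin by (intro member_le_sum) (auto simp: H_def)
    finally show ?thesis .
  qed
  have far: "(\<Sum>j=4..m. N j * D j) \<le> (\<Sum>y | adj v y. B y)" for m
  proof -
    define F where "F = {x. d v x \<in> {4..m}}"
    have F: "finite F" "F \<subseteq> {x. rho adj x v \<ge> 2}"
      using finite_subset[OF _ finite_ball[of v m]] dist_sym[of _ v]
      by (auto simp: F_def rho_def)
    have "(\<Sum>j=4..m. N j * D j) = (\<Sum>x\<in>F. D (d v x))"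
      unfolding F_def N_def by (rule sum_over_spheres[symmetric]) simp
    also have "\<dots> \<le> (\<Sum>x\<in>F. \<Sum>y | adj v y. H y x)"
      by (rule sum_mono) (auto intro: D_le simp: F_def)
    also have "\<dots> = (\<Sum>y | adj v y. \<Sum>x\<in>F. H y x)" by (rule sum.swap)
    also have "\<dots> \<le> (\<Sum>y | adj v y. B y)"
      by (rule sum_mono) (use B F adj_sym in auto)
    finally show ?thesis .
  qed
  define A where "A = (\<Sum>j=1..3. N j * D j) + (\<Sum>y | adj v y. B y)"
  have ND: "0 \<le> N j * D j" for j by (simp add: N_def D_def)
  have "(\<Sum>j<m. N (Suc j) * cmod (\<kappa> (Suc j) - \<kappa> j)) \<le> A" for m
  proof -
    have "(\<Sum>j<m. N (Suc j) * cmod (\<kappa> (Suc j) - \<kappa> j)) = (\<Sum>j=1..m. N j * D j)"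
      by (simp add: sum.atLeast1_atMost_eq D_def)
    also have "\<dots> \<le> (\<Sum>j\<in>{1..3} \<union> {4..m}. N j * D j)"
      by (rule sum_mono2) (auto intro: ND)
    also have "\<dots> = (\<Sum>j=1..3. N j * D j) + (\<Sum>j=4..m. N j * D j)"
      by (rule sum.union_disjoint) auto
    also have "\<dots> \<le> A" using far[of m] by (simp add: A_def)
    finally show ?thesis .
  qed
  moreover have "\<kappa> \<longlonglongrightarrow> 0"
  proof -
    have "inj p" by (rule inj_on_inverseI[of _ "d v"]) (rule p)
    then have "filterlim p cofinite sequentially"
      unfolding filterlim_iff cofinite_eq_sequentially[symmetric] eventually_cofinite
      using finite_vimageI[of "{x. \<not> P x}" p for P] by (simp add: vimage_def)
    with van show ?thesis
      unfolding vanishes_at_infinity_def \<kappa>_def by (rule filterlim_compose)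
  qed
  moreover have "0 \<le> N n" for n by (simp add: N_def)
  ultimately have sums: "(\<Sum>n<M. N n * cmod (\<kappa> n)) \<le> A" for M
    using weighted_sum_le_of_differences[of N \<kappa> A M] N2 by blast
  have "(\<Sum>x\<in>F. cmod (k x y)) \<le> A" if "finite F" for F y
  proof -
    obtain g where g: "g \<in> isometries adj" "g y = v"
      using ex_isometry[of y y v v] by auto
    then have "inj_on g F" by (auto simp: isometries_def bij_def intro: inj_on_subset)
    have "k x y = \<kappa> (d v (g x))" for x
      using kernel_isometry[OF T g(1), of x y] g(2) k\<kappa>[of "g x" v] by simp
    then have "(\<Sum>x\<in>F. cmod (k x y)) = (\<Sum>x\<in>g ` F. cmod (\<kappa> (d v x)))"
      using \<open>inj_on g F\<close> by (simp add: sum.reindex)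
    also have "\<dots> \<le> (\<Sum>x | d v x \<in> {..<Suc (Max (d v ` g ` F))}. cmod (\<kappa> (d v x)))"
      using that finite_ball[of v] by (intro sum_mono2) (auto simp: less_Suc_eq_le)
    also have "\<dots> = (\<Sum>n<Suc (Max (d v ` g ` F)). N n * cmod (\<kappa> n))"
      unfolding N_def by (rule sum_over_spheres) simp
    also have "\<dots> \<le> A" by (rule sums)
    finally show ?thesis .
  qed
  then show ?thesis by blast
qed

lemma finite_of_q_0:
  assumes "q = 0" shows "finite (UNIV :: 'a set)"
proof -
  have uniq: "b = c" if "adj a b" "adj a c" for a b c
    using card_adj[of a] that assms card_le_Suc0_iff_eq[OF finite_adj[of a]] by auto
  fix v
  have "adj\<^sup>*\<^sup>* v x \<Longrightarrow> x = v \<or> adj v x" for x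
    by (induction rule: rtranclp_induct) (use uniq adj_sym in blast)+
  then have "UNIV \<subseteq> insert v {x. adj v x}" using adj_connected by auto
  then show ?thesis using finite_adj finite_subset by blast
qed

lemma kernel_L1_bounded:
  assumes q: "q \<noteq> 1" and T: "G_invariant adj T" "is_kernel T k"
    and van: "vanishes_at_infinity (\<lambda>x. k x v)" and hor: "local_Hormander adj v k"
  shows "(\<Sum>\<^sub>\<infinity>x. ennreal (cmod (k x v))) < \<infinity>" "extends_bounded_to_L1 L1 L1_norm T"
proof -
  have "\<exists>K. \<forall>F y. finite F \<longrightarrow> (\<Sum>x\<in>F. cmod (k x y)) \<le> K"
  proof (cases "q = 0")
    case True
    note fin = finite_of_q_0[OF True]
    have "(\<Sum>x\<in>F. cmod (k x y)) \<le> (\<Sum>y\<in>UNIV. \<Sum>x\<in>UNIV. cmod (k x y))" for F y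
    proof -
      have "(\<Sum>x\<in>F. cmod (k x y)) \<le> (\<Sum>x\<in>UNIV. cmod (k x y))"
        by (rule sum_mono2) (use fin in auto)
      also have "\<dots> \<le> (\<Sum>y\<in>UNIV. \<Sum>x\<in>UNIV. cmod (k x y))"
        by (rule member_le_sum) (use fin in \<open>auto intro: sum_nonneg\<close>)
      finally show ?thesis .
    qed
    then show ?thesis by blast
  next
    case False
    with q have "2 \<le> q" by simp
    then show ?thesis by (rule kernel_column_sums_bounded[OF _ T van hor])
  qed
  then obtain K where K: "\<And>F y. finite F \<Longrightarrow> (\<Sum>x\<in>F. cmod (k x y)) \<le> K" by blast
  show "(\<Sum>\<^sub>\<infinity>x. ennreal (cmod (k x v))) < \<infinity>"
    using K by (subst infsum_ennreal_finite_iff) auto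
  show "extends_bounded_to_L1 L1 L1_norm T" by (rule extends_bounded_to_L1_schur[OF T(2) K])
qed

lemma finite_tree_ball: "r \<le> 1 \<Longrightarrow> finite (tree_ball adj c r)"
  by (rule finite_subset[OF _ finite_ball[of c 2]]) (auto simp: tree_ball_def rho_def)

lemma sum_cmod_h1_atom_le_1:
  assumes "h1_atom adj a" "finite F" shows "(\<Sum>x\<in>F. cmod (a x)) \<le> 1"
proof -
  obtain c r where "r \<le> 1" "{x. a x \<noteq> 0} \<subseteq> tree_ball adj c r"
      "L2_norm a \<le> mu (tree_ball adj c r) powr (-1/2)"
    using assms(1) unfolding h1_atom_def H1_atom_def global_atom_def by fastforce
  then show ?thesis using sum_cmod_le_1_of_supported[OF finite_tree_ball] assms(2) by blast
qed

lemma neighbour_difference_in_H1: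
  assumes "adj y v"
  shows "(\<lambda>x. (if x = y then 1 else 0) - (if x = v then 1 else 0)) \<in> H1 adj"
proof -
  define B where "B = tree_ball adj v 1"
  define t where "t = mu B powr (-1/2) / 2"
  define f where "f x = (if x = y then 1 else 0) - (if x = v then 1 else (0::complex))" for x
  define a where "a x = of_real t * f x" for x
  have yv: "y \<noteq> v" using assms adj_irrefl by auto
  have finB: "finite B" by (simp add: B_def finite_tree_ball)
  have inB: "y \<in> B" "v \<in> B"
    using dist_adj[OF adj_sym[OF assms]] by (auto simp: B_def tree_ball_def rho_def)
  have "0 < mu B" using finB inB by (auto simp: mu_def card_gt_0_iff)
  then have t: "0 < t" by (simp add: t_def)
  have a0: "a x = 0" if "x \<notin> {y, v}" for x using that by (simp add: a_def f_def)
  have ay: "a y = t" "a v = - t" using yv by (auto simp: a_def f_def)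
  have s2: "((\<lambda>x. (cmod (a x))\<^sup>2) has_sum 2 * t\<^sup>2) UNIV"
  proof -
    have "((\<lambda>x. (cmod (a x))\<^sup>2) has_sum 2 * t\<^sup>2) {y, v}"
      by (rule has_sum_finiteI) (use yv ay in auto)
    then show ?thesis by (rule has_sum_cong_neutral[THEN iffD1, rotated -1]) (use a0 in auto)
  qed
  have s1: "(a has_sum 0) UNIV"
  proof -
    have "(a has_sum 0) {y, v}" by (rule has_sum_finiteI) (use yv ay in auto)
    then show ?thesis by (rule has_sum_cong_neutral[THEN iffD1, rotated -1]) (use a0 in auto)
  qed
  have "H1_atom adj a"
    unfolding H1_atom_def
  proof (intro conjI exI)
    show "a \<in> L2" unfolding L2_def using s2 has_sum_imp_summable by blast
    show "{x. a x \<noteq> 0} \<subseteq> tree_ball adj v 1"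
    proof
      fix x assume "x \<in> {x. a x \<noteq> 0}"
      then have "x \<in> {y, v}" using a0[of x] by auto
      then show "x \<in> tree_ball adj v 1" using inB unfolding B_def by auto
    qed
    have "L2_norm a = sqrt (2 * t\<^sup>2)" using infsumI[OF s2] by (simp add: L2_norm_def)
    also have "\<dots> \<le> 2 * t" using t by (intro real_le_lsqrt) (auto simp: power2_eq_square)
    finally show "L2_norm a \<le> mu (tree_ball adj v 1) powr (-1/2)" by (simp add: t_def B_def)
  qed (use s1 in auto)
  then have "atomic_decomposition (H1_atom adj) f (\<lambda>j. if j = 0 then 1 / of_real t else 0) (\<lambda>_. a)"
    unfolding atomic_decomposition_def
  proof (intro conjI allI)
    show "summable (\<lambda>j. cmod (if j = 0 then 1 / of_real t else 0))"
      by (rule summable_finite[of "{0}"]) auto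
    show "(\<lambda>j. (if j = 0 then 1 / of_real t else 0) * a x) sums f x" for x
      using sums_finite[of "{0}" "\<lambda>j. (if j = 0 then 1 / of_real t else 0) * a x"] t
      by (simp add: a_def)
  qed
  then show ?thesis unfolding atomic_space_def f_def by blast
qed

lemma H1_bounded_imp_local_Hormander:
  assumes ext: "extends_bounded_to_L1 (H1 adj) (H1_norm adj) T" and k: "is_kernel T k"
  shows "local_Hormander adj v k"
proof -
  have nb: "{y. adj y v} = {y. adj v y}" using adj_sym by blast
  have "(\<Sum>\<^sub>\<infinity>x\<in>{x. rho adj x v \<ge> 2}. ennreal (cmod (k x y - k x v))) < \<infinity>" if "adj y v" for y
  proof -
    define f where "f x = (if x = y then 1 else 0) - (if x = v then 1 else (0::complex))" for x
    have yv: "y \<noteq> v" using that adj_irrefl by auto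
    then have supp: "{x. f x \<noteq> 0} = {y, v}" by (auto simp: f_def)
    then have fs: "f \<in> finsupp" by (simp add: finsupp_def)
    moreover have "f \<in> H1 adj" unfolding f_def by (rule neighbour_difference_in_H1[OF that])
    ultimately have "T f \<in> L1"
      using ext unfolding extends_bounded_to_L1_def by (metis IntI)
    moreover have "T f x = k x y - k x v" for x
      using k fs yv unfolding is_kernel_def by (simp add: supp) (simp add: f_def)
    ultimately have "(\<Sum>x\<in>F. cmod (k x y - k x v)) \<le> L1_norm (T f)" if "finite F" for F
      using sum_cmod_le_L1_norm[of "T f" F] that by simp
    then show ?thesis by (subst infsum_ennreal_finite_iff) auto
  qed
  moreover have "{y. adj v y} \<noteq> {}" using card_adj[of v] by (metis card.empty add_is_0 one_neq_zero)
  ultimately show ?thesis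
    unfolding local_Hormander_def nb using finite_adj[of v] adj_sym by (subst Max_less_iff) auto
qed

end

theorem proposition4p6:
  fixes adj :: "'a \<Rightarrow> 'a \<Rightarrow> bool"
    and q :: nat
    and v :: 'a
    and T :: "('a \<Rightarrow> complex) \<Rightarrow> ('a \<Rightarrow> complex)"
    and k :: "'a \<Rightarrow> 'a \<Rightarrow> complex"
  assumes "homogeneous_tree adj q"
    and "linear_operator_on finsupp T"
    and "G_invariant adj T"
    and "is_kernel T k"
  shows
    "(extends_bounded_to_L1 (H1 adj) (H1_norm adj) T \<longrightarrow> local_Hormander adj v k)
     \<and>
     (q \<noteq> 1 \<and> vanishes_at_infinity (\<lambda>x. k x v) \<longrightarrow>
        local_Hormander adj v k \<longrightarrow>
          (\<Sum>\<^sub>\<infinity>x. ennreal (cmod (k x v))) < \<infinity> \<and> extends_bounded_to_L1 L1 L1_norm T)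
     \<and>
     (extends_bounded_to_L1 (h1 adj) (h1_norm adj) T \<longrightarrow>
        extends_bounded_to_L1 (H1 adj) (H1_norm adj) T)
     \<and>
     (q \<noteq> 1 \<and> vanishes_at_infinity (\<lambda>x. k x v) \<longrightarrow>
        (extends_bounded_to_L1 (H1 adj) (H1_norm adj) T \<longleftrightarrow>
         extends_bounded_to_L1 (h1 adj) (h1_norm adj) T))"
proof -
  interpret htree adj q by standard (rule assms(1))
  have h1_H1: "h1_atom adj a" if "H1_atom adj a" for a using that by (simp add: h1_atom_def)
  have sub: "H1 adj \<subseteq> h1 adj" by (rule atomic_space_mono) (rule h1_H1)
  have i: "extends_bounded_to_L1 (H1 adj) (H1_norm adj) T \<Longrightarrow> local_Hormander adj v k"
    by (rule H1_bounded_imp_local_Hormander[OF _ assms(4)])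
  have h1_H1_ext: "extends_bounded_to_L1 (H1 adj) (H1_norm adj) T"
    if "extends_bounded_to_L1 (h1 adj) (h1_norm adj) T"
    using that sub
  proof (rule extends_bounded_to_L1_subspace)
    fix f assume f: "f \<in> H1 adj"
    show "0 \<le> h1_norm adj f \<and> h1_norm adj f \<le> H1_norm adj f"
      using atomic_norm_nonneg[of f "h1_atom adj"] atomic_norm_antimono[OF h1_H1 f] f sub by auto
  qed
  have L1_h1_ext: "extends_bounded_to_L1 (h1 adj) (h1_norm adj) T"
    if "extends_bounded_to_L1 L1 L1_norm T"
    using that
  proof (rule extends_bounded_to_L1_subspace)
    show "h1 adj \<subseteq> L1" using atomic_space_L1_bound(1)[OF sum_cmod_h1_atom_le_1] by blast
    fix f assume "f \<in> h1 adj"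
    then show "0 \<le> L1_norm f \<and> L1_norm f \<le> h1_norm adj f"
      using L1_norm_nonneg atomic_space_L1_bound(2)[OF sum_cmod_h1_atom_le_1] by blast
  qed
  show ?thesis
    using i h1_H1_ext L1_h1_ext kernel_L1_bounded[OF _ assms(3,4), of v] by blast
qed

end
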